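(* Let $G$ and $H$ be connected graphs such that the join $G\vee H$ is not complete. Then $tpc(G\vee H)=3$.
   Context: All graphs are simple, finite and undirected. A graph is total-colored if all its vertices and edges are assigned colors. A path in a total-colored graph is a total proper path if (i) any two adjacent edges on the path differ in color, (ii) any two adjacent internal vertices of the path differ in color, and (iii) every internal vertex of the path differs in color from the edges of the path incident with it. A total-colored graph is total-proper connected if any two vertices are joined by a total proper path. For a connected graph $G$, the total proper connection number $tpc(G)$ is the smallest number of colors in a total-coloring making $G$ total-proper connected. The join $G\vee H$ has vertex set $V(G)\cup V(H)$ (disjoint union) and edge set $E(G)\cup E(H)\cup\{uv: u\in V(G), v\in V(H)\}$. *)

theory Defs
  imports "Graph_Theory.Kuratowski" "Graph_Theory.Vertex_Walk"
begin

text \<open>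
  A finite simple undirected graph is a \<open>pair_graph\<close>: a finite, symmetric, loop-free set of pairs,
  so that an undirected edge appears as two opposite arcs. Colours of edges must not depend on the
  orientation, so they are assigned to the unordered pairs collected by \<open>edges\<close>.
\<close>

definition edges :: "'a pair_pre_digraph \<Rightarrow> 'a set set" where
  "edges G = (\<lambda>(u, v). {u, v}) ` parcs G"

definition join :: "'a pair_pre_digraph \<Rightarrow> 'b pair_pre_digraph \<Rightarrow> ('a + 'b) pair_pre_digraph" where
  "join G H = \<lparr>
     pverts = pverts G <+> pverts H,
     parcs = {(Inl u, Inl u') |u u'. (u, u') \<in> parcs G}
           \<union> {(Inr v, Inr v') |v v'. (v, v') \<in> parcs H}
           \<union> {(Inl u, Inr v) |u v. u \<in> pverts G \<and> v \<in> pverts H}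
           \<union> {(Inr v, Inl u) |u v. u \<in> pverts G \<and> v \<in> pverts H} \<rparr>"

text \<open>
  A total-colouring is a pair of functions, \<open>cv\<close> on vertices and \<open>ce\<close> on edges; only their values
  on \<open>pverts G\<close> and \<open>edges G\<close> matter. The internal vertices of a path \<open>p\<close>, given by its list of
  vertices, are the \<open>p ! i\<close> with \<open>0 < i\<close> and \<open>i + 1 < length p\<close>.
\<close>

definition total_proper_path ::
    "'a pair_pre_digraph \<Rightarrow> ('a \<Rightarrow> nat) \<Rightarrow> ('a set \<Rightarrow> nat) \<Rightarrow> 'a list \<Rightarrow> bool" where
  "total_proper_path G cv ce p \<longleftrightarrow>
     vpath p (with_proj G) \<and>
     (\<forall>i. i + 2 < length p \<longrightarrow> ce {p ! i, p ! (i + 1)} \<noteq> ce {p ! (i + 1), p ! (i + 2)}) \<and>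
     (\<forall>i. 0 < i \<and> i + 2 < length p \<longrightarrow> cv (p ! i) \<noteq> cv (p ! (i + 1))) \<and>
     (\<forall>i. 0 < i \<and> i + 1 < length p \<longrightarrow>
        cv (p ! i) \<noteq> ce {p ! (i - 1), p ! i} \<and> cv (p ! i) \<noteq> ce {p ! i, p ! (i + 1)})"

definition total_proper_connected ::
    "'a pair_pre_digraph \<Rightarrow> ('a \<Rightarrow> nat) \<Rightarrow> ('a set \<Rightarrow> nat) \<Rightarrow> bool" where
  "total_proper_connected G cv ce \<longleftrightarrow>
     (\<forall>u \<in> pverts G. \<forall>v \<in> pverts G. u \<noteq> v \<longrightarrow>
        (\<exists>p. total_proper_path G cv ce p \<and> hd p = u \<and> last p = v))"

text \<open>
  The number of colours is the number of colours actually used. For a connected graph the minimum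
  ranges over a nonempty set: give all vertices and edges distinct colours.
\<close>

definition tpc :: "'a pair_pre_digraph \<Rightarrow> nat" where
  "tpc G = (LEAST k. \<exists>cv ce. card (cv ` pverts G \<union> ce ` edges G) = k \<and>
                             total_proper_connected G cv ce)"

lemma pair_graph_join:
  assumes "pair_graph G" "pair_graph H"
  shows "pair_graph (join G H)"
proof -
  interpret G: pair_graph G by fact
  interpret H: pair_graph H by fact
  have wf: "parcs (join G H) \<subseteq> pverts (join G H) \<times> pverts (join G H)"
    by (auto simp: join_def dest: G.wellformed' H.wellformed')
  have fin: "finite (pverts (join G H))"
    by (simp add: join_def G.pair_finite_verts H.pair_finite_verts)
  then have "finite (parcs (join G H))"
    using wf by (meson finite_SigmaI finite_subset)
  moreover have "sym (parcs (join G H))"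
    by (auto simp: sym_def join_def intro: G.arcs_symmetric H.arcs_symmetric)
  moreover have "fst e \<noteq> snd e" if "e \<in> parcs (join G H)" for e
    using that by (auto simp: join_def dest: G.no_loops' H.no_loops')
  ultimately show ?thesis
    using wf fin by unfold_locales (auto simp: symmetric_def)
qed

end

theory Submission
  imports Defs
begin

text \<open>
  A path joining two non-adjacent vertices has an internal vertex, and this vertex and its two
  incident path edges already need three colours.

  Conversely, let \<open>A\<close> be a maximal independent set of \<open>G\<close> with complement \<open>B\<close>; as \<open>G\<close> is
  connected, every vertex has a neighbour in the other part (unless \<open>G\<close> is a single vertex).
  Choose \<open>X\<close> and its complement \<open>Y\<close> in \<open>H\<close> likewise. Colour the vertices of \<open>A\<close>, \<open>B\<close>, \<open>X\<close>, \<open>Y\<close> by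
  \<open>3\<close>, \<open>1\<close>, \<open>2\<close>, \<open>1\<close>, the edges of \<open>G\<close> by \<open>2\<close>, those of \<open>H\<close> by \<open>3\<close>, and the edges \<open>AX\<close>, \<open>AY\<close>,
  \<open>BX\<close> by \<open>1\<close>, \<open>2\<close>, \<open>3\<close>. For \<open>z\<close> in \<open>X\<close>, vertices \<open>u\<close>, \<open>v\<close> of \<open>G\<close> in different parts are joined
  by \<open>u z v\<close>, and vertices in the same part by \<open>u u' z v\<close> with \<open>u'\<close> a neighbour of \<open>u\<close> in the
  other part. A vertex of \<open>A\<close> serves \<open>H\<close> in the same way.
\<close>

text \<open>A vertex outside a maximal independent set has a neighbour in it, as it could be added
  otherwise. Connectedness gives a vertex of the set some neighbour, and independence puts that
  neighbour outside.\<close>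

lemma exists_dominating_partition:
  fixes G :: "'a pair_pre_digraph"
  assumes "pair_graph G" and "connected (with_proj G)"
  obtains A where "A \<subseteq> pverts G" and "A \<noteq> {}"
    and "\<And>b. b \<in> pverts G - A \<Longrightarrow> \<exists>a\<in>A. (b, a) \<in> parcs G"
    and "\<And>a. a \<in> A \<Longrightarrow> pverts G \<noteq> {a} \<Longrightarrow> \<exists>b\<in>pverts G - A. (a, b) \<in> parcs G"
proof -
  interpret pair_graph G by fact
  let ?I = "{A. A \<subseteq> pverts G \<and> (\<forall>a\<in>A. \<forall>b\<in>A. (a, b) \<notin> parcs G)}"
  have "finite ?I" and "{} \<in> ?I"
    by auto
  from finite_has_maximal2[OF this]
  obtain A where A: "A \<in> ?I" and max: "\<forall>A'\<in>?I. A \<subseteq> A' \<longrightarrow> A = A'"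
    by (elim bexE conjE)
  have dom: "\<exists>a\<in>A. (b, a) \<in> parcs G" if b: "b \<in> pverts G - A" for b
  proof (rule ccontr)
    assume none: "\<not> ?thesis"
    then have "(a, b) \<notin> parcs G" if "a \<in> A" for a
      using that arcs_symmetric by blast
    with none A b have "insert b A \<in> ?I"
      using no_loops' by auto
    with max have "A = insert b A"
      by (meson subset_insertI)
    with b show False
      by blast
  qed
  have nonempty: "pverts G \<noteq> {}"
    using assms(2) by (auto simp: connected_def strongly_connected_def)
  with dom have "A \<noteq> {}"
    by blast
  have "\<exists>b\<in>pverts G - A. (a, b) \<in> parcs G" if a: "a \<in> A" and "pverts G \<noteq> {a}" for a
  proof -
    have "\<not> pverts G \<subseteq> {a}"
      using that(2) nonempty by (simp add: subset_singleton_iff)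
    then obtain c where c: "c \<in> pverts G" "c \<noteq> a"
      by blast
    then have "a \<rightarrow>\<^sup>*\<^bsub>mk_symmetric (with_proj G)\<^esub> c"
      using assms(2) a A by (auto simp: connected_def strongly_connected_def)
    then have "(a, c) \<in> (parcs (mk_symmetric (with_proj G)))\<^sup>*"
      using reachable_rtranclI by fastforce
    \<comment> \<open>As \<open>c\<close> differs from \<open>a\<close>, the walk is nonempty and
      has a first arc. \<open>mk_symmetric\<close> adds no arc to the symmetric
      \<open>G\<close>.\<close>
    with c obtain b where "(a, b) \<in> parcs (mk_symmetric (with_proj G))"
      by (auto elim: converse_rtranclE)
    then have "(a, b) \<in> parcs G"
      using arcs_symmetric by (auto simp: mk_symmetric_def)
    moreover have "b \<in> pverts G - A"
      using \<open>(a, b) \<in> parcs G\<close> a A wellformed' by blast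
    ultimately show ?thesis
      by blast
  qed
  with that[of A] A dom \<open>A \<noteq> {}\<close> show thesis
    by blast
qed

lemma (in pair_graph) total_proper_path_2:
  assumes "(a, b) \<in> parcs G"
  shows "total_proper_path G cv ce [a, b]"
  using assms no_loops' wellformed'
  by (auto simp: total_proper_path_def vpath_def vwalk_def)

lemma (in pair_graph) total_proper_path_3:
  assumes "(a, b) \<in> parcs G" "(b, c) \<in> parcs G" "a \<noteq> c"
    and "ce {a, b} \<noteq> ce {b, c}" "cv b \<noteq> ce {a, b}" "cv b \<noteq> ce {b, c}"
  shows "total_proper_path G cv ce [a, b, c]"
  using assms no_loops' wellformed'
  by (auto simp: total_proper_path_def vpath_def vwalk_def less_Suc_eq)

text \<open>Consecutive vertices differ because there are no loops, so only the other three pairs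
  are assumed distinct.\<close>

lemma (in pair_graph) total_proper_path_4:
  assumes "(a, b) \<in> parcs G" "(b, c) \<in> parcs G" "(c, d) \<in> parcs G"
    and "a \<noteq> c" "a \<noteq> d" "b \<noteq> d"
    and "ce {a, b} \<noteq> ce {b, c}" "ce {b, c} \<noteq> ce {c, d}" "cv b \<noteq> cv c"
    and "cv b \<noteq> ce {a, b}" "cv b \<noteq> ce {b, c}" "cv c \<noteq> ce {b, c}" "cv c \<noteq> ce {c, d}"
  shows "total_proper_path G cv ce [a, b, c, d]"
  using assms no_loops' wellformed'
  by (auto simp: total_proper_path_def vpath_def vwalk_def less_Suc_eq)

lemma (in pair_graph) finite_colours: "finite (cv ` pverts G \<union> ce ` edges G)"
  by (simp add: edges_def)

lemma (in pair_graph) three_le_card_colours: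
  assumes tpc: "total_proper_connected G cv ce"
    and uv: "u \<in> pverts G" "v \<in> pverts G" "u \<noteq> v" "(u, v) \<notin> parcs G"
  shows "3 \<le> card (cv ` pverts G \<union> ce ` edges G)"
proof -
  from tpc uv obtain p where p: "total_proper_path G cv ce p" "hd p = u" "last p = v"
    unfolding total_proper_connected_def by blast
  then have walk: "set p \<subseteq> pverts G" "set (vwalk_arcs p) \<subseteq> parcs G" "p \<noteq> []"
    by (auto simp: total_proper_path_def vpath_def vwalk_def)
  \<comment> \<open>A path on one vertex would give \<open>u = v\<close>, and one on two vertices
    would make \<open>(u, v)\<close> an arc.\<close>
  then obtain y z r where p_eq: "p = u # y # z # r"
    using p uv by (cases p rule: vwalk_arcs.cases; cases "tl (tl p)") auto
  let ?C = "{ce {u, y}, cv y, ce {y, z}}"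
  have arcs: "(u, y) \<in> parcs G" "(y, z) \<in> parcs G"
    using walk p_eq by auto
  have "\<forall>i. i + 2 < length p \<longrightarrow> ce {p ! i, p ! (i + 1)} \<noteq> ce {p ! (i + 1), p ! (i + 2)}"
    and "\<forall>i. 0 < i \<and> i + 1 < length p \<longrightarrow>
        cv (p ! i) \<noteq> ce {p ! (i - 1), p ! i} \<and> cv (p ! i) \<noteq> ce {p ! i, p ! (i + 1)}"
    using p(1) unfolding total_proper_path_def by blast+
  from this(1)[THEN spec[of _ 0]] this(2)[THEN spec[of _ 1]]
  have "ce {u, y} \<noteq> ce {y, z}" "cv y \<noteq> ce {u, y}" "cv y \<noteq> ce {y, z}"
    by (simp_all add: p_eq)
  then have "card ?C = 3"
    by auto
  moreover have "{u, y} \<in> edges G" "{y, z} \<in> edges G"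
    using arcs unfolding edges_def by force+
  then have "?C \<subseteq> cv ` pverts G \<union> ce ` edges G"
    using wellformed'[OF arcs(1)] by auto
  ultimately show ?thesis
    using card_mono[OF finite_colours] by metis
qed

lemma join_simps:
  "pverts (join G H) = pverts G <+> pverts H"
  "(Inl a, Inl a') \<in> parcs (join G H) \<longleftrightarrow> (a, a') \<in> parcs G"
  "(Inr b, Inr b') \<in> parcs (join G H) \<longleftrightarrow> (b, b') \<in> parcs H"
  "(Inl a, Inr b) \<in> parcs (join G H) \<longleftrightarrow> a \<in> pverts G \<and> b \<in> pverts H"
  "(Inr b, Inl a) \<in> parcs (join G H) \<longleftrightarrow> a \<in> pverts G \<and> b \<in> pverts H"
  by (auto simp: join_def)

lemma join_three_colouring:
  fixes G :: "'a pair_pre_digraph" and H :: "'b pair_pre_digraph"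
  assumes "pair_graph G" and "connected (with_proj G)"
    and "pair_graph H" and "connected (with_proj H)"
  obtains cv ce where "range cv \<union> range ce \<subseteq> {1, 2, 3}"
    and "total_proper_connected (join G H) cv ce"
proof -
  obtain A where A: "A \<subseteq> pverts G" "A \<noteq> {}"
    and B_nbr: "\<And>b. b \<in> pverts G - A \<Longrightarrow> \<exists>a\<in>A. (b, a) \<in> parcs G"
    and A_nbr: "\<And>a. a \<in> A \<Longrightarrow> pverts G \<noteq> {a} \<Longrightarrow> \<exists>b\<in>pverts G - A. (a, b) \<in> parcs G"
    using exists_dominating_partition[OF assms(1,2)] by metis
  obtain X where X: "X \<subseteq> pverts H" "X \<noteq> {}"
    and Y_nbr: "\<And>y. y \<in> pverts H - X \<Longrightarrow> \<exists>x\<in>X. (y, x) \<in> parcs H"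
    and X_nbr: "\<And>x. x \<in> X \<Longrightarrow> pverts H \<noteq> {x} \<Longrightarrow> \<exists>y\<in>pverts H - X. (x, y) \<in> parcs H"
    using exists_dominating_partition[OF assms(3,4)] by metis
  obtain w z where w: "w \<in> A" "w \<in> pverts G" and z: "z \<in> X" "z \<in> pverts H"
    using A X by blast
  define cv :: "'a + 'b \<Rightarrow> nat" where
    "cv = case_sum (\<lambda>a. if a \<in> A then 3 else 1) (\<lambda>x. if x \<in> X then 2 else 1)"
  \<comment> \<open>The last default gives 3 to the edges BY as well as BX. Below, an edge BY occurs
    only as a path of a single edge, which carries no colour condition.\<close>
  define ce :: "('a + 'b) set \<Rightarrow> nat" where
    "ce e = (if e \<subseteq> range Inl then 2 else if e \<subseteq> range Inr then 3
      else if e \<subseteq> Inl ` A \<union> Inr ` X then 1 else if e \<subseteq> Inl ` A \<union> range Inr then 2 else 3)" for e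
  have cv: "cv (Inl a) = (if a \<in> A then 3 else 1)" "cv (Inr x) = (if x \<in> X then 2 else 1)" for a x
    by (auto simp: cv_def)
  have ce: "ce {Inl a, Inl a'} = 2" "ce {Inr x, Inr x'} = 3"
    "ce {Inl a, Inr x} = (if a \<in> A then if x \<in> X then 1 else 2 else 3)"
    "ce {Inr x, Inl a} = (if a \<in> A then if x \<in> X then 1 else 2 else 3)" for a a' x x'
    by (auto simp: ce_def)
  interpret pair_graph "join G H"
    using assms pair_graph_join by blast
  note simps = cv ce join_simps w z
  have "\<exists>p. total_proper_path (join G H) cv ce p \<and> hd p = s \<and> last p = t"
    if s: "s \<in> pverts (join G H)" and t: "t \<in> pverts (join G H)" and "s \<noteq> t" for s t
  proof (cases s; cases t)
    fix u v assume eq: "s = Inl u" "t = Inl v"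
    then have uv: "u \<in> pverts G" "v \<in> pverts G" "u \<noteq> v"
      using s t \<open>s \<noteq> t\<close> by (auto simp: join_simps)
    show ?thesis
    proof (cases "u \<in> A \<longleftrightarrow> v \<in> A")
      case True
      \<comment> \<open>A second vertex excludes the exceptional case of
        \<open>A_nbr\<close>.\<close>
      have "pverts G \<noteq> {u}"
        using uv by auto
      with uv A_nbr B_nbr A obtain u' where "(u, u') \<in> parcs G" "u' \<in> pverts G" "u' \<in> A \<longleftrightarrow> u \<notin> A"
        by (metis DiffD1 DiffD2 DiffI subsetD)
      \<comment> \<open>For \<open>u\<close> in \<open>A\<close> the edges get 2, 3, 1 and the inner
        vertices 1, 2; otherwise the edges get 2, 1, 3 and the inner vertices 3, 2.\<close>
      with uv True have "total_proper_path (join G H) cv ce [Inl u, Inl u', Inr z, Inl v]"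
        by (intro total_proper_path_4) (auto simp: simps)
      with eq show ?thesis by force
    next
      case False
      with uv have "total_proper_path (join G H) cv ce [Inl u, Inr z, Inl v]"
        by (intro total_proper_path_3) (auto simp: simps)
      with eq show ?thesis by force
    qed
  next
    fix u v assume eq: "s = Inr u" "t = Inr v"
    then have uv: "u \<in> pverts H" "v \<in> pverts H" "u \<noteq> v"
      using s t \<open>s \<noteq> t\<close> by (auto simp: join_simps)
    show ?thesis
    proof (cases "u \<in> X \<longleftrightarrow> v \<in> X")
      case True
      have "pverts H \<noteq> {u}"
        using uv by auto
      with uv X_nbr Y_nbr X obtain u' where "(u, u') \<in> parcs H" "u' \<in> pverts H" "u' \<in> X \<longleftrightarrow> u \<notin> X"
        by (metis DiffD1 DiffD2 DiffI subsetD)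
      \<comment> \<open>For \<open>u\<close> in \<open>X\<close> the edges get 3, 2, 1 and the inner
        vertices 1, 3; otherwise the edges get 3, 1, 2 and the inner vertices 2, 3.\<close>
      with uv True have "total_proper_path (join G H) cv ce [Inr u, Inr u', Inl w, Inr v]"
        by (intro total_proper_path_4) (auto simp: simps)
      with eq show ?thesis by force
    next
      case False
      with uv have "total_proper_path (join G H) cv ce [Inr u, Inl w, Inr v]"
        by (intro total_proper_path_3) (auto simp: simps)
      with eq show ?thesis by force
    qed
  next
    fix u v assume "s = Inl u" "t = Inr v"
    with s t have "total_proper_path (join G H) cv ce [s, t]"
      by (intro total_proper_path_2) (auto simp: join_simps)
    then show ?thesis by force
  next
    fix u v assume "s = Inr u" "t = Inl v"
    with s t have "total_proper_path (join G H) cv ce [s, t]"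
      by (intro total_proper_path_2) (auto simp: join_simps)
    then show ?thesis by force
  qed
  then have "total_proper_connected (join G H) cv ce"
    by (simp add: total_proper_connected_def)
  moreover have "range cv \<union> range ce \<subseteq> {1, 2, 3}"
    by (auto simp: cv_def ce_def split: sum.splits if_splits)
  ultimately show thesis
    using that by blast
qed

theorem theorem2p1:
  fixes G :: "'a pair_pre_digraph" and H :: "'b pair_pre_digraph"
  assumes "pair_graph G" and "connected (with_proj G)"
    and "pair_graph H" and "connected (with_proj H)"
    and "\<not> (\<exists>n. complete_digraph n (with_proj (join G H)))"
  shows "tpc (join G H) = 3"
proof -
  interpret pair_graph "join G H"
    using assms pair_graph_join by blast
  \<comment> \<open>Taking \<open>n\<close> to be the number of vertices, non-completeness becomes a
    statement about the arc set alone.\<close>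
  have "parcs (join G H) \<noteq> {(u, v). (u, v) \<in> pverts (join G H) \<times> pverts (join G H) \<and> u \<noteq> v}"
    using assms(5) by (auto simp: complete_digraph_pair_def)
  moreover have "parcs (join G H) \<subseteq> {(u, v). (u, v) \<in> pverts (join G H) \<times> pverts (join G H) \<and> u \<noteq> v}"
    using wellformed' by (auto dest: no_loops')
  ultimately obtain u v where uv: "u \<in> pverts (join G H)" "v \<in> pverts (join G H)"
      "u \<noteq> v" "(u, v) \<notin> parcs (join G H)"
    by auto
  obtain cv ce where colours: "range cv \<union> range ce \<subseteq> {1, 2, 3 :: nat}"
    and conn: "total_proper_connected (join G H) cv ce"
    using join_three_colouring[OF assms(1-4)] .
  \<comment> \<open>This bounds the colours used by three; the lower bound makes the number exactly
    three, and applied to an arbitrary colouring it gives minimality.\<close>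
  have "card (cv ` pverts (join G H) \<union> ce ` edges (join G H)) \<le> card {1, 2, 3 :: nat}"
    using colours by (intro card_mono) auto
  with three_le_card_colours[OF conn uv]
  have "card (cv ` pverts (join G H) \<union> ce ` edges (join G H)) = 3"
    by simp
  with conn three_le_card_colours[OF _ uv] show ?thesis
    unfolding tpc_def by (intro Least_equality) blast+
qed

end
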